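(* Let $r_0=(\sqrt5-1)/2$ and $Q(r_0)=\left\{\frac{1+r_0}{r_0^2(1-r_0)}\,C\right\}^{1/2}$. Let $f=h+\overline{g}\in\mathcal{H}_\alpha(C)$ with $0<\alpha<Q(r_0)$, where $h(z)=\sum_{n=1}^{\infty}a_nz^n$ and $g(z)=\sum_{n=2}^{\infty}b_nz^n$ for $z\in\mathbb{D}$. Then for every $n\ge2$, $$|a_n|+|b_n|\le\frac{1}{n\,r_0^{n-1}Q(r_0)}\inf_{0<t<1}\left\{\frac{Q(r_0)^2-\alpha^2(1-t)^2}{t^{n-1}(1-t)}\right\}<\frac{Q(r_0)}{r_0^{n-1}}\left(1+\frac1{n-1}\right)^{n-1}.$$
   Context: $\mathbb{D}$ is the open unit disk in $\mathbb{C}$ and $\mathbb{D}_r=\{z:|z|<r\}$. A harmonic mapping in $\mathbb{D}$ is a complex-valued function $f=h+\overline{g}$ with $h,g$ analytic in $\mathbb{D}$; $f_z=h'$, $f_{\overline z}=\overline{g'}$, Jacobian $J_f=|h'|^2-|g'|^2$. "Sense-preserving" means (locally univalent and) $|g'(z)|<|h'(z)|$ for all $z\in\mathbb{D}$. $\mathcal{H}$ denotes the set of all sense-preserving harmonic mappings $f=h+\overline{g}$ in $\mathbb{D}$ with $h(0)=g(0)=f_{\overline z}(0)=0$. Put $S_f(r)=\int_{\mathbb{D}_r}J_f\,dA$, where $dA$ is the normalized area measure on $\mathbb{D}$ (so $A(\mathbb{D})=1$). $\mathcal{H}(C)$ is the class of all $f\in\mathcal{H}$ with $C=\sup_{0<r<1}S_f(r)<\infty$,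 and for $\alpha\ge0$, $\mathcal{H}_\alpha(C)$ is the class of all $f\in\mathcal{H}(C)$ with $f_z(0)=\alpha$. *)

theory Defs
  imports "HOL-Complex_Analysis.Complex_Analysis"
begin

text \<open>Mappings of the unit disk are total functions on \<open>complex\<close>; only their values on
  \<open>ball 0 1\<close> matter.\<close>

definition harmonic_parts ::
    "(complex \<Rightarrow> complex) \<Rightarrow> (complex \<Rightarrow> complex) \<Rightarrow> (complex \<Rightarrow> complex) \<Rightarrow> bool" where
  "harmonic_parts f h g \<longleftrightarrow>
     h holomorphic_on ball 0 1 \<and> g holomorphic_on ball 0 1 \<and>
     (\<forall>z\<in>ball 0 1. f z = h z + cnj (g z))"

text \<open>Wirtinger derivatives \<open>(f\<^sub>x - \<i> f\<^sub>y) / 2\<close> and \<open>(f\<^sub>x + \<i> f\<^sub>y) / 2\<close>; the partial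
  derivatives are the real derivative applied to \<open>1\<close> and \<open>\<i>\<close>.
  See \<open>wirtinger_harmonic\<close> below for \<open>f = h + cnj g\<close>.\<close>

definition dz :: "(complex \<Rightarrow> complex) \<Rightarrow> complex \<Rightarrow> complex" where
  "dz f z = (frechet_derivative f (at z) 1 - \<i> * frechet_derivative f (at z) \<i>) / 2"

definition dzbar :: "(complex \<Rightarrow> complex) \<Rightarrow> complex \<Rightarrow> complex" where
  "dzbar f z = (frechet_derivative f (at z) 1 + \<i> * frechet_derivative f (at z) \<i>) / 2"

lemma wirtinger_harmonic:
  assumes "harmonic_parts f h g" and z: "z \<in> ball 0 1"
  shows "dz f z = deriv h z" and "dzbar f z = cnj (deriv g z)"
proof -
  have h: "(h has_derivative (\<lambda>w. deriv h z * w)) (at z)"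
    and g: "(g has_derivative (\<lambda>w. deriv g z * w)) (at z)"
    and f: "\<And>w. w \<in> ball 0 1 \<Longrightarrow> h w + cnj (g w) = f w"
    using assms holomorphic_derivI[of _ "ball 0 1" z]
    by (auto simp: harmonic_parts_def has_field_derivative_def)
  have "((\<lambda>w. h w + cnj (g w)) has_derivative
      (\<lambda>w. deriv h z * w + cnj (deriv g z * w))) (at z)"
    by (intro has_derivative_add h has_derivative_cnj g)
  then have "(f has_derivative (\<lambda>w. deriv h z * w + cnj (deriv g z * w))) (at z)"
    by (rule has_derivative_transform_within_open[OF _ open_ball z f])
  then have D: "frechet_derivative f (at z) = (\<lambda>w. deriv h z * w + cnj (deriv g z * w))"
    by (rule frechet_derivative_at[symmetric])
  show "dz f z = deriv h z" "dzbar f z = cnj (deriv g z)"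
    unfolding dz_def dzbar_def D by (simp_all add: algebra_simps)
qed

definition jacobian :: "(complex \<Rightarrow> complex) \<Rightarrow> complex \<Rightarrow> real" where
  "jacobian f z = (cmod (dz f z))\<^sup>2 - (cmod (dzbar f z))\<^sup>2"

definition locally_univalent :: "(complex \<Rightarrow> complex) \<Rightarrow> bool" where
  "locally_univalent f \<longleftrightarrow>
     (\<forall>z\<in>ball 0 1. \<exists>U. open U \<and> z \<in> U \<and> U \<subseteq> ball 0 1 \<and> inj_on f U)"

definition sense_preserving :: "(complex \<Rightarrow> complex) \<Rightarrow> bool" where
  "sense_preserving f \<longleftrightarrow>
     locally_univalent f \<and> (\<forall>z\<in>ball 0 1. cmod (dzbar f z) < cmod (dz f z))"

definition \<H> :: "(complex \<Rightarrow> complex) set" where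
  "\<H> = {f. sense_preserving f \<and> dzbar f 0 = 0 \<and>
            (\<exists>h g. harmonic_parts f h g \<and> h 0 = 0 \<and> g 0 = 0)}"

definition disk_area :: "complex measure" where
  "disk_area = uniform_measure lborel (ball 0 1)"

definition S :: "(complex \<Rightarrow> complex) \<Rightarrow> real \<Rightarrow> real" where
  "S f r = (LINT z:ball 0 r|disk_area. jacobian f z)"

text \<open>The explicit \<open>bdd_above\<close> expresses that the supremum is finite; \<open>Sup\<close> on the reals is
  only meaningful for bounded sets.\<close>

definition \<H>_C :: "real \<Rightarrow> (complex \<Rightarrow> complex) set" where
  "\<H>_C C = {f \<in> \<H>. bdd_above (S f ` {0<..<1}) \<and> C = (SUP r\<in>{0<..<1}. S f r)}"

definition \<H>_\<alpha> :: "real \<Rightarrow> real \<Rightarrow> (complex \<Rightarrow> complex) set" where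
  "\<H>_\<alpha> \<alpha> C = {f \<in> \<H>_C C. dz f 0 = of_real \<alpha>}"

end

theory Submission
  imports Defs
begin

text \<open>
  By the Schwarz lemma the dilatation \<open>g'/h'\<close> is bounded by \<open>\<bar>z\<bar>\<close>, so for unimodular \<open>\<epsilon>\<close> the
  analytic function \<open>\<phi> = h' + \<epsilon> g'\<close> satisfies \<open>\<bar>\<phi>\<bar>\<^sup>2 \<le> (1 + r) / (1 - r) J\<^sub>f\<close> on the disk of
  radius \<open>r\<close>. Hence its area integral there is at most \<open>(1 + r) / (1 - r) C\<close>, and Bessel's
  inequality for the orthogonal system \<open>z\<^sup>j\<close>, applied with \<open>j = 0\<close> and \<open>j = m := n - 1\<close>, bounds
  the coefficients of \<open>\<phi>\<close>. Bounding the integral of \<open>\<bar>z\<bar>^(2m)\<close> from below on the annulus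
  \<open>\<bar>z\<bar>\<^sup>2 > t r\<^sup>2\<close> gives, for \<open>r = r\<^sub>0\<close>, the inequality \<open>\<alpha>\<^sup>2 + c\<^sup>2 x \<le> Q\<^sup>2\<close> with
  \<open>x = t\<^sup>m (1 - t)\<close> and \<open>c = n r\<^sub>0\<^sup>m (\<bar>a\<^sub>n\<bar> + \<bar>b\<^sub>n\<bar>)\<close>. This implies the bound for the given \<open>t\<close>,
  because \<open>Q\<^sup>2 - \<alpha>\<^sup>2 (1 - t)\<^sup>2\<close> dominates both \<open>Q\<^sup>2 x\<close> and \<open>Q\<^sup>2 - \<alpha>\<^sup>2\<close>. The strict
  inequality comes from the value at \<open>t = m / n\<close>, which maximises \<open>x\<close>.
\<close>

subsection \<open>Rotation invariance of the plane Lebesgue measure\<close>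

lemma borel_measurable_Complex [measurable (raw)]:
  assumes [measurable]: "f \<in> borel_measurable M" "g \<in> borel_measurable M"
  shows "(\<lambda>x. Complex (f x) (g x)) \<in> borel_measurable M"
  unfolding Complex_eq by measurable

text \<open>Boxes determine Lebesgue measure, and a complex box corresponds to a product of two
  intervals. This gives access to Tonelli's theorem in real coordinates.\<close>

lemma lborel_complex_eq:
  "(lborel :: complex measure) = distr (lborel \<Otimes>\<^sub>M lborel) borel (\<lambda>p. Complex (fst p) (snd p))"
proof (rule lborel_eqI)
  fix l u :: complex
  assume lu: "\<And>b. b \<in> Basis \<Longrightarrow> l \<bullet> b \<le> u \<bullet> b"
  have le: "Re l \<le> Re u" "Im l \<le> Im u"
    using lu[of 1] lu[of \<i>] by (auto simp: Basis_complex_def)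
  have "(\<lambda>p. Complex (fst p) (snd p)) -` box l u \<inter> space (lborel \<Otimes>\<^sub>M lborel) =
      {Re l <..< Re u} \<times> {Im l <..< Im u}"
    by (auto simp: box_def Basis_complex_def space_pair_measure)
  then show "emeasure (distr (lborel \<Otimes>\<^sub>M lborel) borel (\<lambda>p. Complex (fst p) (snd p))) (box l u) =
      ennreal (\<Prod>b\<in>Basis. (u - l) \<bullet> b)"
    using le by (simp add: emeasure_distr lborel.emeasure_pair_measure_Times Basis_complex_def
        ennreal_mult)
qed simp

text \<open>Both orders of integration are recorded because a shear fixes one coordinate and
  translates the other; the translated one has to be integrated first.\<close>

lemma nn_integral_lborel_complex:
  assumes [measurable]: "f \<in> borel_measurable borel"
  shows "(\<integral>\<^sup>+z. f z \<partial>lborel) = (\<integral>\<^sup>+x. \<integral>\<^sup>+y. f (Complex x y) \<partial>lborel \<partial>lborel)"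
    and "(\<integral>\<^sup>+z. f z \<partial>lborel) = (\<integral>\<^sup>+y. \<integral>\<^sup>+x. f (Complex x y) \<partial>lborel \<partial>lborel)"
proof -
  have "(\<integral>\<^sup>+z. f z \<partial>lborel) = (\<integral>\<^sup>+p. f (Complex (fst p) (snd p)) \<partial>(lborel \<Otimes>\<^sub>M lborel))"
    by (subst lborel_complex_eq) (simp add: nn_integral_distr)
  then show *: "(\<integral>\<^sup>+z. f z \<partial>lborel) = (\<integral>\<^sup>+x. \<integral>\<^sup>+y. f (Complex x y) \<partial>lborel \<partial>lborel)"
    by (simp add: lborel.nn_integral_fst[symmetric])
  show "(\<integral>\<^sup>+z. f z \<partial>lborel) = (\<integral>\<^sup>+y. \<integral>\<^sup>+x. f (Complex x y) \<partial>lborel \<partial>lborel)"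
    unfolding * by (rule lborel_pair.Fubini'[symmetric]) measurable
qed

text \<open>On each line \<open>Im z = y\<close> the shear is a translation by \<open>k * y\<close>,
  which leaves the inner integral unchanged.\<close>

lemma nn_integral_lborel_shear_Re:
  assumes [measurable]: "f \<in> borel_measurable borel"
  shows "(\<integral>\<^sup>+z. f (z + of_real (k * Im z)) \<partial>lborel) = (\<integral>\<^sup>+z. f z \<partial>lborel)"
proof -
  have "(\<integral>\<^sup>+x. f (Complex (x + k * y) y) \<partial>lborel) = (\<integral>\<^sup>+x. f (Complex x y) \<partial>lborel)" for y
    using nn_integral_real_affine[of "\<lambda>x. f (Complex x y)" 1 "k * y"]
    by (simp add: add.commute)
  moreover have "Complex x y + of_real (k * Im (Complex x y)) = Complex (x + k * y) y" for x y
    by (simp add: complex_eq_iff)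
  ultimately show ?thesis
    by (subst (1 2) nn_integral_lborel_complex(2)) (simp_all del: of_real_mult)
qed

lemma nn_integral_lborel_shear_Im:
  assumes [measurable]: "f \<in> borel_measurable borel"
  shows "(\<integral>\<^sup>+z. f (z + \<i> * of_real (k * Re z)) \<partial>lborel) = (\<integral>\<^sup>+z. f z \<partial>lborel)"
proof -
  have "(\<integral>\<^sup>+y. f (Complex x (y + k * x)) \<partial>lborel) = (\<integral>\<^sup>+y. f (Complex x y) \<partial>lborel)" for x
    using nn_integral_real_affine[of "\<lambda>y. f (Complex x y)" 1 "k * x"]
    by (simp add: add.commute)
  moreover have "Complex x y + \<i> * of_real (k * Re (Complex x y)) = Complex x (y + k * x)" for x y
    by (simp add: complex_eq_iff)
  ultimately show ?thesis
    by (subst (1 2) nn_integral_lborel_complex(1)) (simp_all del: of_real_mult)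
qed

text \<open>A rotation other than the half turn is a composition of three shears.\<close>

lemma nn_integral_lborel_rotate:
  assumes [measurable]: "f \<in> borel_measurable borel" and \<omega>: "cmod \<omega> = 1" "\<omega> \<noteq> - 1"
  shows "(\<integral>\<^sup>+z. f (\<omega> * z) \<partial>lborel) = (\<integral>\<^sup>+z. f z \<partial>lborel)"
proof -
  \<comment> \<open>For \<open>\<omega> = cis \<theta>\<close> this is -tan(\<theta>/2), and the
    rotation is the product of shears with factors k, sin \<theta>, k. At the half turn the tangent
    has its pole.\<close>
  define k where "k = - Im \<omega> / (1 + Re \<omega>)"
  have norm: "(Re \<omega>)\<^sup>2 + (Im \<omega>)\<^sup>2 = 1"
    using \<omega>(1) by (simp add: cmod_def)
  have ne: "1 + Re \<omega> \<noteq> 0"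
  proof
    assume "1 + Re \<omega> = 0"
    then have "Re \<omega> = - 1" by simp
    with norm have "Im \<omega> = 0" by simp
    with \<open>Re \<omega> = - 1\<close> \<omega>(2) show False by (simp add: complex_eq_iff)
  qed
  have k: "1 + k * Im \<omega> = Re \<omega>" "k * (1 + Re \<omega>) = - Im \<omega>"
    using ne norm unfolding k_def by (simp_all add: field_simps power2_eq_square)
  define p where "p z = z + of_real (k * Im z)" for z
  define q where "q z = z + \<i> * of_real (Im \<omega> * Re z)" for z
  have [measurable]: "p \<in> borel_measurable borel" "q \<in> borel_measurable borel"
    unfolding p_def q_def by measurable
  have "p (q (p z)) = \<omega> * z" for z
  proof (rule complex_eqI)
    have "Re (p (q (p z))) = Re z * (1 + k * Im \<omega>) + Im z * (k * (1 + (1 + k * Im \<omega>)))"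
      by (simp add: p_def q_def algebra_simps)
    then show "Re (p (q (p z))) = Re (\<omega> * z)"
      unfolding k by (simp add: algebra_simps)
    have "Im (p (q (p z))) = Re z * Im \<omega> + Im z * (1 + k * Im \<omega>)"
      by (simp add: p_def q_def algebra_simps)
    then show "Im (p (q (p z))) = Im (\<omega> * z)"
      unfolding k by (simp add: algebra_simps)
  qed
  then have "(\<integral>\<^sup>+z. f (\<omega> * z) \<partial>lborel) = (\<integral>\<^sup>+z. f (p (q (p z))) \<partial>lborel)"
    by simp
  also have "\<dots> = (\<integral>\<^sup>+z. f (p (q z)) \<partial>lborel)"
    using nn_integral_lborel_shear_Re[of "\<lambda>z. f (p (q z))" k] by (simp add: p_def)
  also have "\<dots> = (\<integral>\<^sup>+z. f (p z) \<partial>lborel)"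
    using nn_integral_lborel_shear_Im[of "\<lambda>z. f (p z)" "Im \<omega>"] by (simp add: q_def)
  also have "\<dots> = (\<integral>\<^sup>+z. f z \<partial>lborel)"
    using nn_integral_lborel_shear_Re[of f k] by (simp add: p_def)
  finally show ?thesis .
qed

text \<open>As an equality of measures, the invariance carries over to Bochner integrals through
  \<open>integral_distr\<close>.\<close>

lemma distr_lborel_rotate:
  assumes "cmod \<omega> = 1" "\<omega> \<noteq> - 1"
  shows "distr lborel borel ((*) \<omega>) = lborel"
proof (rule measure_eqI)
  fix A assume A: "A \<in> sets (distr lborel borel ((*) \<omega>))"
  then have [measurable]: "A \<in> sets borel" by simp
  have "emeasure (distr lborel borel ((*) \<omega>)) A = (\<integral>\<^sup>+z. indicator A z \<partial>distr lborel borel ((*) \<omega>))"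
    using A by (subst nn_integral_indicator) auto
  also have "\<dots> = (\<integral>\<^sup>+z. indicator A (\<omega> * z) \<partial>lborel)"
    by (rule nn_integral_distr) auto
  also have "\<dots> = (\<integral>\<^sup>+z. indicator A z \<partial>lborel)"
    using assms by (intro nn_integral_lborel_rotate) auto
  finally show "emeasure (distr lborel borel ((*) \<omega>)) A = emeasure lborel A"
    by simp
qed simp

lemma integral_ball_power_orthogonal:
  assumes "i \<noteq> j"
  shows "(LINT z:ball 0 r|lborel. z ^ i * cnj z ^ j) = 0"
proof -
  \<comment> \<open>Rotating by the angle \<open>\<pi> / (2 (i - j))\<close> multiplies the integrand by \<open>\<i>\<close>.\<close>
  define d where "d = real i - real j"
  have d: "\<bar>d\<bar> \<ge> 1" using assms by (auto simp: d_def)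
  define \<omega> where "\<omega> = cis (pi / (2 * d))"
  have \<omega>n: "cmod \<omega> = 1" by (simp add: \<omega>_def)
  \<comment> \<open>Since |d| is at least 1, the angle is at most \<pi>/2 in modulus, so \<omega> is
    not the excluded half turn.\<close>
  have "\<bar>pi / (2 * d)\<bar> < pi" 
    using d by (simp add: abs_mult divide_less_eq)
  then have "cos (pi / (2 * d)) > - 1"
    using cos_monotone_0_pi[of "\<bar>pi / (2 * d)\<bar>" pi] cos_abs_real[of "pi / (2 * d)"] by simp
  then have \<omega>1: "\<omega> \<noteq> - 1"
    by (auto simp: \<omega>_def complex_eq_iff)
  have "\<omega> ^ i * cnj \<omega> ^ j = cis (real i * (pi / (2 * d)) - real j * (pi / (2 * d)))"
    by (simp add: \<omega>_def Complex.DeMoivre cis_cnj cis_mult)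
  also have "real i * (pi / (2 * d)) - real j * (pi / (2 * d)) = pi / 2"
    unfolding left_diff_distrib[symmetric] d_def[symmetric] using d by auto
  finally have \<omega>i: "\<omega> ^ i * cnj \<omega> ^ j = \<i>" by simp
  let ?F = "\<lambda>z. indicator (ball 0 r) z *\<^sub>R (z ^ i * cnj z ^ j)"
  have meas: "?F \<in> borel_measurable borel"
    by (intro borel_measurable_scaleR borel_measurable_indicator borel_measurable_continuous_onI
        continuous_intros) auto
  have "integral\<^sup>L lborel ?F = integral\<^sup>L (distr lborel borel ((*) \<omega>)) ?F"
    using distr_lborel_rotate[OF \<omega>n \<omega>1] by simp
  also have "\<dots> = integral\<^sup>L lborel (\<lambda>z. ?F (\<omega> * z))"
    using meas by (intro integral_distr) auto
  also have "(\<lambda>z. ?F (\<omega> * z)) = (\<lambda>z. \<i> * ?F z)"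
  proof
    fix z
    have "?F (\<omega> * z) = (\<omega> ^ i * cnj \<omega> ^ j) * ?F z"
      using \<omega>n by (simp add: indicator_def norm_mult power_mult_distrib)
    then show "?F (\<omega> * z) = \<i> * ?F z" by (simp only: \<omega>i)
  qed
  also have "integral\<^sup>L lborel (\<lambda>z. \<i> * ?F z) = \<i> * integral\<^sup>L lborel ?F"
    by (rule integral_mult_right_zero)
  finally have "(1 - \<i>) * integral\<^sup>L lborel ?F = 0"
    by (simp add: algebra_simps)
  moreover have "1 - \<i> \<noteq> 0" by (simp add: complex_eq_iff)
  ultimately show ?thesis
    by (simp add: set_lebesgue_integral_def)
qed


subsection \<open>Bessel's inequality on a disk\<close>

lemma set_integrable_ball_continuous:
  fixes f :: "'a::euclidean_space \<Rightarrow> 'b::{banach,second_countable_topology}"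
  assumes "continuous_on (cball a r) f"
  shows "set_integrable lborel (ball a r) f"
proof (rule set_integrable_subset)
  show "set_integrable lborel (cball a r) f"
    unfolding set_integrable_def using assms by (intro borel_integrable_compact) auto
qed auto

text \<open>On the disk the k-th term is dominated by the constant |c_k| r^k r^j, which is summable
  in k, so sum and integral may be interchanged. Orthogonality then leaves only the term k =
  j.\<close>

lemma set_integral_ball_power_series:
  assumes "0 \<le> r" and c: "summable (\<lambda>k. cmod (c k) * r ^ k)"
    and \<phi>: "\<And>z. z \<in> ball 0 r \<Longrightarrow> (\<lambda>k. c k * z ^ k) sums \<phi> z"
  shows "set_integrable lborel (ball 0 r) (\<lambda>z. \<phi> z * cnj z ^ j)"
    and "(LINT z:ball 0 r|lborel. \<phi> z * cnj z ^ j) =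
      c j * of_real (LINT z:ball 0 r|lborel. cmod z ^ (2 * j))"
proof -
  let ?f = "\<lambda>k z. indicator (ball 0 r) z *\<^sub>R (c k * z ^ k * cnj z ^ j)"
  have suminf: "(\<Sum>k. ?f k z) = indicator (ball 0 r) z *\<^sub>R (\<phi> z * cnj z ^ j)" for z
    using sums_mult2[OF \<phi>, of z "cnj z ^ j"] by (cases "z \<in> ball 0 r") (simp_all add: sums_iff)
  have int: "integrable lborel (?f k)" for k
    using set_integrable_ball_continuous[of 0 r "\<lambda>z. c k * z ^ k * cnj z ^ j"]
    unfolding set_integrable_def by (simp add: continuous_intros)
  have bound: "norm (?f k z) \<le> indicator (ball 0 r) z *\<^sub>R (cmod (c k) * r ^ k * r ^ j)" for k z
  proof (cases "z \<in> ball 0 r")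
    case True
    then have "cmod z ^ k \<le> r ^ k" "cmod z ^ j \<le> r ^ j"
      by (auto intro!: power_mono)
    then have "cmod (c k) * cmod z ^ k * cmod z ^ j \<le> cmod (c k) * r ^ k * r ^ j"
      using \<open>0 \<le> r\<close> by (intro mult_mono) auto
    then show ?thesis using True by (simp add: norm_mult norm_power)
  qed simp
  have fin: "emeasure lborel (ball (0::complex) r) < \<infinity>"
    using emeasure_lborel_ball_finite by blast
  have const: "integrable lborel (\<lambda>z::complex. indicator (ball 0 r) z *\<^sub>R C)" for C :: real
    using fin by (intro integrable_indicator) auto
  \<comment> \<open>\<open>AE\<close> and \<open>summ\<close> are the conditions for termwise
    integration. Both follow from \<open>bound\<close>, the second after integrating over the disk,
    whose area is finite.\<close>
  have AE: "AE z in lborel. summable (\<lambda>k. norm (?f k z))"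
  proof (rule AE_I2)
    fix z :: complex
    show "summable (\<lambda>k. norm (?f k z))"
    proof (rule summable_comparison_test_ev)
      show "summable (\<lambda>k. indicator (ball 0 r) z *\<^sub>R (cmod (c k) * r ^ k * r ^ j))"
        using c by (simp add: summable_mult summable_mult2)
      show "\<forall>\<^sub>F k in sequentially. norm (norm (?f k z)) \<le>
          indicator (ball 0 r) z *\<^sub>R (cmod (c k) * r ^ k * r ^ j)"
        using bound by simp
    qed
  qed
  have summ: "summable (\<lambda>k. \<integral>z. norm (?f k z) \<partial>lborel)"
  proof (rule summable_comparison_test_ev)
    show "summable (\<lambda>k. measure lborel (ball (0::complex) r) * (cmod (c k) * r ^ k * r ^ j))"
      using c by (simp add: summable_mult summable_mult2)
    have "(\<integral>z. norm (?f k z) \<partial>lborel) \<le>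
        measure lborel (ball (0::complex) r) * (cmod (c k) * r ^ k * r ^ j)" for k
    proof -
      have "(\<integral>z. norm (?f k z) \<partial>lborel) \<le>
          (\<integral>z. indicator (ball (0::complex) r) z *\<^sub>R (cmod (c k) * r ^ k * r ^ j) \<partial>lborel)"
        using int bound const by (intro integral_mono integrable_norm) auto
      then show ?thesis using fin by simp
    qed
    then show "\<forall>\<^sub>F k in sequentially. norm (\<integral>z. norm (?f k z) \<partial>lborel) \<le>
        measure lborel (ball (0::complex) r) * (cmod (c k) * r ^ k * r ^ j)"
      by (simp add: integral_nonneg_AE)
  qed
  show "set_integrable lborel (ball 0 r) (\<lambda>z. \<phi> z * cnj z ^ j)"
    using integrable_suminf[OF int AE summ] by (simp only: set_integrable_def suminf)
  have "integral\<^sup>L lborel (?f k) =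
      (if k = j then c j * of_real (LINT z:ball 0 r|lborel. cmod z ^ (2 * j)) else 0)" for k
  proof -
    have "integral\<^sup>L lborel (?f k) = c k * (LINT z:ball 0 r|lborel. z ^ k * cnj z ^ j)"
      unfolding set_lebesgue_integral_def
      by (subst integral_mult_right_zero[symmetric]) (simp add: ac_simps)
    moreover have "z ^ j * cnj z ^ j = of_real (cmod z ^ (2 * j))" for z
      by (simp flip: power_mult_distrib add: complex_norm_square[symmetric] power_mult)
    moreover have "(LINT z:ball (0::complex) r|lborel. of_real (cmod z ^ (2 * j))) =
        complex_of_real (LINT z:ball 0 r|lborel. cmod z ^ (2 * j))"
      by (rule set_integral_complex_of_real)
    ultimately show ?thesis
      using integral_ball_power_orthogonal[of k j r] by (cases "k = j") auto
  qed
  then have "(\<lambda>k. if k = j then c j * of_real (LINT z:ball 0 r|lborel. cmod z ^ (2 * j)) else 0)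
      sums (\<integral>z. (\<Sum>k. ?f k z) \<partial>lborel)"
    using sums_integral[OF int AE summ] by simp
  then show "(LINT z:ball 0 r|lborel. \<phi> z * cnj z ^ j) =
      c j * of_real (LINT z:ball 0 r|lborel. cmod z ^ (2 * j))"
    unfolding suminf set_lebesgue_integral_def[symmetric]
    using sums_single[of j "\<lambda>_. c j * of_real (LINT z:ball 0 r|lborel. cmod z ^ (2 * j))"]
      sums_unique2 by blast
qed

text \<open>The polynomial \<open>p\<close> is the orthogonal projection of \<phi> onto the span of
  the z^j with j in J. Hence \<phi> and \<open>p\<close> have the same inner product
  \<open>E\<close> with \<open>p\<close>, and integrating |\<phi> - p|^2 \<ge> 0 gives the
  claim.\<close>

lemma bessel_inequality_ball:
  assumes "0 \<le> r" and c: "summable (\<lambda>k. cmod (c k) * r ^ k)"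
    and \<phi>: "\<And>z. z \<in> ball 0 r \<Longrightarrow> (\<lambda>k. c k * z ^ k) sums \<phi> z"
    and int: "set_integrable lborel (ball 0 r) (\<lambda>z. (cmod (\<phi> z))\<^sup>2)"
    and J: "finite J"
  shows "(\<Sum>j\<in>J. (cmod (c j))\<^sup>2 * (LINT z:ball 0 r|lborel. cmod z ^ (2 * j)))
    \<le> (LINT z:ball 0 r|lborel. (cmod (\<phi> z))\<^sup>2)"
proof -
  define p where "p z = (\<Sum>j\<in>J. c j * z ^ j)" for z
  define E where "E = (\<Sum>j\<in>J. (cmod (c j))\<^sup>2 * (LINT z:ball 0 r|lborel. cmod z ^ (2 * j)))"
  \<comment> \<open>Allowing any coefficients that agree with \<open>c\<close> on \<open>J\<close>
    lets one computation serve both \<phi> and \<open>p\<close>.\<close>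
  have pair: "set_integrable lborel (ball 0 r) (\<lambda>z. \<psi> z * cnj (p z)) \<and>
      (LINT z:ball 0 r|lborel. \<psi> z * cnj (p z)) = of_real E"
    if d: "summable (\<lambda>k. cmod (d k) * r ^ k)" "\<And>j. j \<in> J \<Longrightarrow> d j = c j"
      and \<psi>: "\<And>z. z \<in> ball 0 r \<Longrightarrow> (\<lambda>k. d k * z ^ k) sums \<psi> z" for d \<psi>
  proof -
    note * = set_integral_ball_power_series[OF \<open>0 \<le> r\<close> d(1) \<psi>]
    have eq: "\<psi> z * cnj (p z) = (\<Sum>j\<in>J. cnj (c j) * (\<psi> z * cnj z ^ j))" for z
      by (simp add: p_def sum_distrib_left ac_simps)
    have i: "set_integrable lborel (ball 0 r) (\<lambda>z. cnj (c j) * (\<psi> z * cnj z ^ j))" for j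
      using *(1)[of j] by (intro set_integrable_mult_right)
    have "cnj (c j) * (d j * of_real (LINT z:ball 0 r|lborel. cmod z ^ (2 * j))) =
        of_real ((cmod (c j))\<^sup>2 * (LINT z:ball 0 r|lborel. cmod z ^ (2 * j)))" if "j \<in> J" for j
      using d(2)[OF that] by (simp add: complex_norm_square del: of_real_power)
    then have "cnj (c j) * (LINT z:ball 0 r|lborel. \<psi> z * cnj z ^ j) =
        of_real ((cmod (c j))\<^sup>2 * (LINT z:ball 0 r|lborel. cmod z ^ (2 * j)))" if "j \<in> J" for j
      using that by (simp only: *(2))
    then have "(\<Sum>j\<in>J. cnj (c j) * (LINT z:ball 0 r|lborel. \<psi> z * cnj z ^ j)) = of_real E"
      unfolding E_def of_real_sum by (intro sum.cong) auto
    moreover have "(LINT z:ball 0 r|lborel. \<psi> z * cnj (p z)) =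
        (\<Sum>j\<in>J. LINT z:ball 0 r|lborel. cnj (c j) * (\<psi> z * cnj z ^ j))"
      using i unfolding eq set_integrable_def set_lebesgue_integral_def scaleR_sum_right
      by (rule Bochner_Integration.integral_sum)
    ultimately have "(LINT z:ball 0 r|lborel. \<psi> z * cnj (p z)) = of_real E"
      by simp
    then show ?thesis
      using i unfolding eq set_integrable_def scaleR_sum_right by auto
  qed
  have \<phi>p: "set_integrable lborel (ball 0 r) (\<lambda>z. \<phi> z * cnj (p z))"
      "(LINT z:ball 0 r|lborel. \<phi> z * cnj (p z)) = of_real E"
    using pair[OF c _ \<phi>] by auto
  \<comment> \<open>Coefficients set to 0 outside \<open>J\<close> exhibit \<open>p\<close> itself
    as a power series.\<close>
  have "(\<lambda>k. cmod (if k \<in> J then c k else 0) * r ^ k) = (\<lambda>k. if k \<in> J then cmod (c k) * r ^ k else 0)"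
      "(\<lambda>k. (if k \<in> J then c k else 0) * z ^ k) = (\<lambda>k. if k \<in> J then c k * z ^ k else 0)" for z
    by auto
  then have pp: "set_integrable lborel (ball 0 r) (\<lambda>z. p z * cnj (p z))"
      "(LINT z:ball 0 r|lborel. p z * cnj (p z)) = of_real E"
    using pair[of "\<lambda>k. if k \<in> J then c k else 0" p] J
    by (simp_all add: p_def sums_If_finite_set summable_If_finite_set)
  have le: "2 * Re (\<phi> z * cnj (p z)) - Re (p z * cnj (p z)) \<le> (cmod (\<phi> z))\<^sup>2" for z
  proof -
    have "(cmod (\<phi> z - p z))\<^sup>2 =
        (cmod (\<phi> z))\<^sup>2 - (2 * Re (\<phi> z * cnj (p z)) - Re (p z * cnj (p z)))"
      unfolding cmod_power2 by (simp add: power2_eq_square algebra_simps)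
    then show ?thesis
      using zero_le_power2[of "cmod (\<phi> z - p z)"] by linarith
  qed
  have Re: "set_integrable lborel (ball 0 r) (\<lambda>z. Re (F z)) \<and>
      (LINT z:ball 0 r|lborel. Re (F z)) = Re (LINT z:ball 0 r|lborel. F z)"
    if "set_integrable lborel (ball 0 r) F" for F :: "complex \<Rightarrow> complex"
    using that integrable_Re[of lborel] integral_Re[of lborel]
    unfolding set_integrable_def set_lebesgue_integral_def by fastforce
  have i: "set_integrable lborel (ball 0 r) (\<lambda>z. 2 * Re (\<phi> z * cnj (p z)))"
      "set_integrable lborel (ball 0 r) (\<lambda>z. Re (p z * cnj (p z)))"
    by (intro set_integrable_mult_right conjunct1[OF Re[OF \<phi>p(1)]] conjunct1[OF Re[OF pp(1)]])+
  have "(LINT z:ball 0 r|lborel. 2 * Re (\<phi> z * cnj (p z)) - Re (p z * cnj (p z))) =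
      2 * (LINT z:ball 0 r|lborel. Re (\<phi> z * cnj (p z))) - (LINT z:ball 0 r|lborel. Re (p z * cnj (p z)))"
    by (simp only: set_integral_diff(2)[OF i] set_integral_mult_right)
  also have "\<dots> = E"
    using Re[OF \<phi>p(1)] Re[OF pp(1)] unfolding \<phi>p(2) pp(2) by (simp only: Re_complex_of_real)
  finally have "E = (LINT z:ball 0 r|lborel. 2 * Re (\<phi> z * cnj (p z)) - Re (p z * cnj (p z)))" ..
  also have "\<dots> \<le> (LINT z:ball 0 r|lborel. (cmod (\<phi> z))\<^sup>2)"
    using le by (intro set_integral_mono set_integral_diff(1) i int)
  finally show ?thesis unfolding E_def .
qed

text \<open>The annulus where |z| is at least sqrt(t) r has area \<pi> r^2 (1 - t), and there
  |z|^(2m) is at least t^m r^(2m). The free parameter t becomes the variable of the final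
  infimum.\<close>

lemma set_integral_ball_norm_power_ge:
  assumes "0 < r" "0 < t" "t < 1"
  shows "pi * r\<^sup>2 * (r ^ (2 * m) * (t ^ m * (1 - t))) \<le> (LINT z:ball (0::complex) r|lborel. cmod z ^ (2 * m))"
proof -
  define s where "s = sqrt t * r"
  have s: "0 < s" "s < r" using assms by (auto simp: s_def)
  have area: "measure lborel (ball (0::complex) \<rho>) = pi * \<rho>\<^sup>2" if "0 \<le> \<rho>" for \<rho>
    using content_ball[OF that, of "0::complex"] by (simp add: unit_ball_vol_2)
  have ind: "integrable lborel (\<lambda>z. indicator (ball (0::complex) r - ball 0 s) z *\<^sub>R s ^ (2 * m))"
  proof (intro integrable_scaleR_left integrable_real_indicator)
    have "emeasure lborel (ball (0::complex) r - ball 0 s) \<le> emeasure lborel (ball (0::complex) r)"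
      by (intro emeasure_mono) auto
    also have "\<dots> < \<infinity>"
      using emeasure_lborel_ball_finite by simp
    finally show "emeasure lborel (ball (0::complex) r - ball 0 s) < \<infinity>" .
  qed auto
  have "pi * r\<^sup>2 * (r ^ (2 * m) * (t ^ m * (1 - t))) = (pi * r\<^sup>2 - pi * s\<^sup>2) * s ^ (2 * m)"
    using assms
    by (simp add: s_def power_mult_distrib power_mult real_sqrt_pow2 right_diff_distrib left_diff_distrib)
  also have "\<dots> = measure lborel (ball (0::complex) r - ball 0 s) * s ^ (2 * m)"
    using s area[of r] area[of s] emeasure_lborel_ball_finite[of "0::complex" r]
    by (subst measure_Diff) auto
  also have "\<dots> = (\<integral>z. indicator (ball (0::complex) r - ball 0 s) z *\<^sub>R s ^ (2 * m) \<partial>lborel)"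
    using ind by simp
  also have "\<dots> \<le> (LINT z:ball (0::complex) r|lborel. cmod z ^ (2 * m))"
    unfolding set_lebesgue_integral_def
  proof (rule integral_mono)
    show "integrable lborel (\<lambda>z. indicator (ball (0::complex) r - ball 0 s) z *\<^sub>R s ^ (2 * m))"
      by (rule ind)
    show "integrable lborel (\<lambda>z. indicator (ball (0::complex) r) z *\<^sub>R cmod z ^ (2 * m))"
      using set_integrable_ball_continuous[of "0::complex" r "\<lambda>z. cmod z ^ (2 * m)"]
      unfolding set_integrable_def by (simp add: continuous_intros)
    show "indicator (ball (0::complex) r - ball 0 s) z *\<^sub>R s ^ (2 * m) \<le>
        indicator (ball 0 r) z *\<^sub>R cmod z ^ (2 * m)" for z
      using s by (auto simp: indicator_def intro!: power_mono)
  qed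
  finally show ?thesis .
qed

subsection \<open>Area of harmonic mappings and coefficients\<close>

text \<open>Normalized area has density 1/\<pi> on the unit disk, and \<open>r \<le> 1\<close> keeps
  the disk of integration inside it.\<close>

lemma set_lebesgue_integral_disk_area:
  fixes F :: "complex \<Rightarrow> real"
  assumes "r \<le> 1" and F: "set_borel_measurable lborel (ball 0 r) F"
  shows "(LINT z:ball 0 r|disk_area. F z) = (LINT z:ball 0 r|lborel. F z) / pi"
proof -
  have "emeasure lborel (ball (0::complex) 1) = ennreal pi"
    using emeasure_ball[of 1 "0::complex"] by (simp add: unit_ball_vol_2)
  then have dens: "disk_area = density lborel (\<lambda>z. ennreal (indicator (ball 0 1) z / pi))"
    unfolding disk_area_def uniform_measure_def
    by (intro arg_cong[where f = "density lborel"] ext)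
      (auto simp: indicator_def divide_ennreal simp flip: ennreal_1)
  have "(indicator (ball 0 1) z / pi) *\<^sub>R (indicator (ball 0 r) z *\<^sub>R F z) =
      (indicator (ball 0 r) z *\<^sub>R F z) / pi" for z
    using \<open>r \<le> 1\<close> by (auto simp: indicator_def)
  moreover have "(\<lambda>z. indicator (ball 0 1) z / pi) \<in> borel_measurable (lborel :: complex measure)"
    by (intro borel_measurable_divide borel_measurable_indicator) auto
  ultimately have "(LINT z:ball 0 r|disk_area. F z) =
      (\<integral>z. (indicator (ball 0 r) z *\<^sub>R F z) / pi \<partial>lborel)"
    unfolding set_lebesgue_integral_def dens
    using F by (subst integral_density) (auto simp only: set_borel_measurable_def, auto)
  then show ?thesis
    by (simp add: set_lebesgue_integral_def)
qed

section \<open>Pointwise comparison of h' + \<epsilon> g' with the Jacobian\<close>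

lemma ex_unimodular_norm_add:
  fixes a b :: complex
  obtains \<epsilon> where "cmod \<epsilon> = 1" "cmod (a + \<epsilon> * b) = cmod a + cmod b"
proof (cases "a = 0 \<or> b = 0")
  case True
  then show ?thesis by (intro that[of 1]) auto
next
  case False
  \<comment> \<open>The factor turns b into the direction of a, so that the moduli add.\<close>
  have "a + sgn a / sgn b * b = sgn a * of_real (cmod a + cmod b)"
    using False by (simp add: sgn_eq field_simps)
  then have "cmod (a + sgn a / sgn b * b) = cmod (sgn a) * \<bar>cmod a + cmod b\<bar>"
    by (simp only: norm_mult norm_of_real)
  with False show ?thesis
    by (intro that[of "sgn a / sgn b"]) (auto simp: norm_divide norm_sgn)
qed

text \<open>The strict inequality makes \<open>p\<close> zero-free, so q/p maps the disk into itself
  and fixes 0; the Schwarz lemma applies.\<close>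

lemma dilatation_le_norm:
  assumes p: "p holomorphic_on ball 0 1" and q: "q holomorphic_on ball 0 1"
    and "q 0 = 0" and less: "\<And>z. z \<in> ball 0 1 \<Longrightarrow> cmod (q z) < cmod (p z)"
    and z: "z \<in> ball 0 1"
  shows "cmod (q z) \<le> cmod z * cmod (p z)"
proof -
  have nz: "p w \<noteq> 0" if "w \<in> ball 0 1" for w
    using less[OF that] by auto
  have "(\<lambda>w. q w / p w) holomorphic_on ball 0 1"
    using nz by (intro holomorphic_intros p q) auto
  moreover have "cmod (q w / p w) < 1" if "cmod w < 1" for w
    using less[of w] nz[of w] that by (simp add: norm_divide)
  ultimately have "cmod (q z / p z) \<le> cmod z"
    using Schwarz_Lemma(1)[of "\<lambda>w. q w / p w" z] \<open>q 0 = 0\<close> z by simp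
  then show ?thesis
    using nz[OF z] by (simp add: norm_divide field_simps)
qed

text \<open>With x + y factored out of both sides, what remains is linear and reduces to
  \<open>y \<le> \<rho> * x\<close>. For x = |h'| and y = |g'| the last factor is the
  Jacobian.\<close>

lemma square_add_le_square_diff:
  fixes x y \<rho> :: real
  assumes "0 \<le> x" "0 \<le> y" "y \<le> \<rho> * x" "\<rho> < 1"
  shows "(x + y)\<^sup>2 \<le> (1 + \<rho>) / (1 - \<rho>) * (x\<^sup>2 - y\<^sup>2)"
proof -
  have "(x + y) * ((x + y) * (1 - \<rho>)) \<le> (x + y) * ((1 + \<rho>) * (x - y))"
    using assms by (intro mult_left_mono) (auto simp: algebra_simps)
  then show ?thesis
    using assms(4) by (simp add: field_simps power2_eq_square)
qed

section \<open>Power series coefficients of the derivatives\<close>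

lemma deriv_sums_diffs:
  fixes f :: "complex \<Rightarrow> complex"
  assumes "\<And>z. z \<in> ball 0 1 \<Longrightarrow> (\<lambda>k. c k * z ^ k) sums f z" and "z \<in> ball 0 1"
  shows "(\<lambda>k. diffs c k * z ^ k) sums deriv f z"
proof -
  have "f holomorphic_on ball 0 1"
    by (rule power_series_holomorphic) (use assms(1) in auto)
  then have "(f has_field_derivative deriv f z) (at z)"
    using assms(2) by (intro holomorphic_derivI) auto
  then show ?thesis
    using assms by (intro termdiffs_sums_strong[of 1 c f]) auto
qed

text \<open>As 0^0 = 1, the constant term survives. Applied to derivatives, this reads off the first
  coefficients of h and g.\<close>

lemma sums_power_series_at_0:
  fixes c :: "nat \<Rightarrow> 'a::real_normed_div_algebra"
  assumes "(\<lambda>k. c k * 0 ^ k) sums s"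
  shows "s = c 0"
  using sums_unique2[OF assms powser_sums_zero] .

text \<open>Bessel's inequality with the two distinct indices 0 and m puts the first coefficient,
  later \<alpha>, beside the one of index m + 1. The shift is due to differentiation.\<close>

lemma coefficient_area_bound:
  assumes f: "f \<in> \<H>_C C" and hg: "harmonic_parts f h g"
    and A: "\<And>z. z \<in> ball 0 1 \<Longrightarrow> (\<lambda>k. A k * z ^ k) sums h z"
    and B: "\<And>z. z \<in> ball 0 1 \<Longrightarrow> (\<lambda>k. B k * z ^ k) sums g z"
    and r: "0 < r" "r < 1" and t: "0 < t" "t < 1" and m: "m \<noteq> 0"
  shows "(cmod (A 1))\<^sup>2 +
      (real (Suc m) * r ^ m * (cmod (A (Suc m)) + cmod (B (Suc m))))\<^sup>2 * (t ^ m * (1 - t))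
    \<le> (1 + r) / (r\<^sup>2 * (1 - r)) * C"
proof -
  note parts = wirtinger_harmonic[OF hg]
  have sp: "cmod (deriv g z) < cmod (deriv h z)" if "z \<in> ball 0 1" for z
  proof -
    have "cmod (dzbar f z) < cmod (dz f z)"
      using f that unfolding \<H>_C_def \<H>_def sense_preserving_def by blast
    then show ?thesis using parts[OF that] by simp
  qed
  have g0: "deriv g 0 = 0"
    using f parts[of 0] by (auto simp: \<H>_C_def \<H>_def)
  have hol: "deriv h holomorphic_on ball 0 1" "deriv g holomorphic_on ball 0 1"
    using hg by (auto simp: harmonic_parts_def intro!: holomorphic_deriv)
  have sub: "cball 0 r \<subseteq> ball (0::complex) 1" using r by auto
  have jac: "jacobian f z = (cmod (deriv h z))\<^sup>2 - (cmod (deriv g z))\<^sup>2" if "z \<in> ball 0 1" for z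
    using parts[OF that] by (simp add: jacobian_def)
  have cont: "continuous_on (cball 0 r) (deriv h)" "continuous_on (cball 0 r) (deriv g)"
    using hol sub holomorphic_on_imp_continuous_on continuous_on_subset by blast+
  have "continuous_on (cball 0 r) (jacobian f)"
    by (rule continuous_on_eq[of _ "\<lambda>z. (cmod (deriv h z))\<^sup>2 - (cmod (deriv g z))\<^sup>2"])
      (use sub jac in \<open>auto intro!: continuous_intros cont\<close>)
  then have Jint: "set_integrable lborel (ball 0 r) (jacobian f)"
    by (rule set_integrable_ball_continuous)
  have "S f r \<le> C"
    using f r by (auto simp: \<H>_C_def intro!: cSUP_upper)
  moreover have "S f r = (LINT z:ball 0 r|lborel. jacobian f z) / pi"
    unfolding S_def using r Jint
    by (intro set_lebesgue_integral_disk_area)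
      (auto simp: set_integrable_def set_borel_measurable_def)
  ultimately have area: "(LINT z:ball 0 r|lborel. jacobian f z) \<le> pi * C"
    by (simp add: field_simps)

  \<comment> \<open>This \<epsilon> is chosen for the index m + 1 alone; the pointwise bound on
    \<phi> holds for every unimodular \<epsilon>.\<close>
  obtain \<epsilon> where \<epsilon>: "cmod \<epsilon> = 1"
      "cmod (A (Suc m) + \<epsilon> * B (Suc m)) = cmod (A (Suc m)) + cmod (B (Suc m))"
    by (rule ex_unimodular_norm_add)
  define \<phi> where "\<phi> z = deriv h z + \<epsilon> * deriv g z" for z
  define c where "c k = diffs A k + \<epsilon> * diffs B k" for k
  have \<phi>: "(\<lambda>k. c k * z ^ k) sums \<phi> z" if "z \<in> ball 0 1" for z
    using sums_add[OF deriv_sums_diffs[OF A that] sums_mult[OF deriv_sums_diffs[OF B that], of \<epsilon>]]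
    by (simp add: \<phi>_def c_def algebra_simps)
  \<comment> \<open>The normalization g'(0) = 0 removes \<epsilon> from the constant coefficient of
    \<phi>.\<close>
  have "B 1 = 0"
    using sums_power_series_at_0[of "diffs B" "deriv g 0"] deriv_sums_diffs[OF B, of 0] g0
    by (simp add: diffs_def)
  then have c0: "cmod (c 0) = cmod (A 1)"
    by (simp add: c_def diffs_def)
  have "c m = of_nat (Suc m) * (A (Suc m) + \<epsilon> * B (Suc m))"
    by (simp add: c_def diffs_def algebra_simps)
  then have cm: "cmod (c m) = real (Suc m) * (cmod (A (Suc m)) + cmod (B (Suc m)))"
    using \<epsilon>(2) by (simp only: norm_mult norm_of_nat)
  have summ: "summable (\<lambda>k. cmod (c k) * r ^ k)"
  proof -
    \<comment> \<open>Convergence at a radius strictly between r and 1 gives absolute convergence at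
      r.\<close>
    define K where "K = (1 + r) / 2"
    have K: "r < K" "K < 1" "0 < K" using r by (auto simp: K_def)
    have "summable (\<lambda>k. norm (c k * of_real r ^ k))"
    proof (rule powser_insidea)
      show "summable (\<lambda>k. c k * of_real K ^ k)"
        using sums_summable[OF \<phi>[of "of_real K"]] K by simp
    qed (use r K in auto)
    then show ?thesis
      using r by (simp add: norm_mult norm_power)
  qed
  have \<phi>int: "set_integrable lborel (ball 0 r) (\<lambda>z. (cmod (\<phi> z))\<^sup>2)"
    unfolding \<phi>_def by (intro set_integrable_ball_continuous continuous_intros cont)
  have le: "(cmod (\<phi> z))\<^sup>2 \<le> (1 + r) / (1 - r) * jacobian f z" if "z \<in> ball 0 r" for z
  proof -
    have z: "z \<in> ball 0 1" using that r by auto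
    have "cmod (deriv g z) \<le> cmod z * cmod (deriv h z)"
      by (rule dilatation_le_norm[OF hol g0 sp z])
    also have "\<dots> \<le> r * cmod (deriv h z)"
      using that by (intro mult_right_mono) auto
    finally have *: "(cmod (deriv h z) + cmod (deriv g z))\<^sup>2 \<le> (1 + r) / (1 - r) * jacobian f z"
      unfolding jac[OF z] using r by (intro square_add_le_square_diff) auto
    have "cmod (\<phi> z) \<le> cmod (deriv h z) + cmod (deriv g z)"
      unfolding \<phi>_def using norm_triangle_ineq[of "deriv h z" "\<epsilon> * deriv g z"] \<epsilon>(1)
      by (simp add: norm_mult)
    then show ?thesis
      using * power_mono[of "cmod (\<phi> z)" _ 2] by (meson norm_ge_zero order_trans)
  qed
  let ?W = "\<lambda>j. LINT z:ball (0::complex) r|lborel. cmod z ^ (2 * j)"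
  have "pi * r\<^sup>2 * ((cmod (c 0))\<^sup>2 + (cmod (c m))\<^sup>2 * (r ^ (2 * m) * (t ^ m * (1 - t)))) =
      (cmod (c 0))\<^sup>2 * (pi * r\<^sup>2) + (cmod (c m))\<^sup>2 * (pi * r\<^sup>2 * (r ^ (2 * m) * (t ^ m * (1 - t))))"
    by (simp add: algebra_simps)
  also have "\<dots> \<le> (cmod (c 0))\<^sup>2 * ?W 0 + (cmod (c m))\<^sup>2 * ?W m"
  proof (intro add_mono mult_left_mono set_integral_ball_norm_power_ge)
    \<comment> \<open>For index 0 the full area of the disk is used; the annulus bound would cost a
      factor 1 - t.\<close>
    have "?W 0 = measure lborel (ball (0::complex) r)"
      using emeasure_lborel_ball_finite[of "0::complex" r] by (simp add: set_lebesgue_integral_def)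
    then show "pi * r\<^sup>2 \<le> ?W 0"
      using r content_ball[of r "0::complex"] by (simp add: unit_ball_vol_2)
  qed (use r t in auto)
  also have "\<dots> = (\<Sum>j\<in>{0, m}. (cmod (c j))\<^sup>2 * ?W j)"
    using m by simp
  also have "\<dots> \<le> (LINT z:ball 0 r|lborel. (cmod (\<phi> z))\<^sup>2)"
    using r \<phi> summ \<phi>int by (intro bessel_inequality_ball) auto
  also have "\<dots> \<le> (LINT z:ball 0 r|lborel. (1 + r) / (1 - r) * jacobian f z)"
    using le \<phi>int Jint by (intro set_integral_mono set_integrable_mult_right) auto
  also have "\<dots> = (1 + r) / (1 - r) * (LINT z:ball 0 r|lborel. jacobian f z)"
    by (rule set_integral_mult_right)
  also have "\<dots> \<le> (1 + r) / (1 - r) * (pi * C)"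
    using area r by (intro mult_left_mono) auto
  also have "\<dots> = pi * r\<^sup>2 * ((1 + r) / (r\<^sup>2 * (1 - r)) * C)"
    using r by (simp add: field_simps)
  finally have "(cmod (c 0))\<^sup>2 + (cmod (c m))\<^sup>2 * (r ^ (2 * m) * (t ^ m * (1 - t)))
      \<le> (1 + r) / (r\<^sup>2 * (1 - r)) * C"
    by (rule mult_left_le_imp_le) (use r in simp)
  then show ?thesis
    unfolding c0 cm by (simp add: power_mult_distrib power_mult power_even_eq ac_simps)
qed

text \<open>The square of c Q x splits as (x Q^2)(c^2 x), and each factor is at most the numerator
  \<open>?R\<close>; the second because \<open>bound\<close> gives c^2 x \<le> Q^2 -
  \<alpha>^2.\<close>

lemma le_divide_of_square_bound:
  fixes \<alpha> c x t Q :: real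
  assumes bound: "\<alpha>\<^sup>2 + c\<^sup>2 * x \<le> Q\<^sup>2" and x: "0 < x" "x \<le> t" and "t < 1" and "0 < Q"
  shows "c \<le> (Q\<^sup>2 - \<alpha>\<^sup>2 * (1 - t)\<^sup>2) / (Q * x)"
proof -
  let ?u = "Q\<^sup>2 - \<alpha>\<^sup>2" and ?R = "Q\<^sup>2 - \<alpha>\<^sup>2 * (1 - t)\<^sup>2"
  have "0 \<le> c\<^sup>2 * x" using x by simp
  then have u: "0 \<le> ?u" using bound by simp
  have t2: "(1 - t)\<^sup>2 \<le> 1 - t"
    using x \<open>t < 1\<close> by (simp add: power2_eq_square mult_left_le)
  have uR: "?u \<le> ?R"
    using t2 x mult_left_mono[of "(1 - t)\<^sup>2" 1 "\<alpha>\<^sup>2"] by simp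
  \<comment> \<open>This combines \<alpha>^2 \<le> Q^2 with (1 - t)^2 \<le> 1 - t \<le> 1 -
    x.\<close>
  have "\<alpha>\<^sup>2 * (1 - t)\<^sup>2 \<le> Q\<^sup>2 * (1 - x)"
    using u t2 x \<open>t < 1\<close> by (intro mult_mono) auto
  then have xR: "x * Q\<^sup>2 \<le> ?R" by (simp add: algebra_simps)
  have "(c * (Q * x))\<^sup>2 = (x * Q\<^sup>2) * (c\<^sup>2 * x)"
    by (simp add: power2_eq_square)
  also have "\<dots> \<le> ?R\<^sup>2"
    unfolding power2_eq_square[of ?R] using bound x u uR xR by (intro mult_mono) auto
  finally have "c * (Q * x) \<le> ?R"
    by (rule power2_le_imp_le) (use u uR in linarith)
  then show ?thesis
    using x \<open>0 < Q\<close> by (simp add: pos_le_divide_eq)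
qed

theorem theorem3:
  fixes f h g :: "complex \<Rightarrow> complex" and a b :: "nat \<Rightarrow> complex"
    and \<alpha> C r0 Q :: real and n :: nat
  assumes "r0 = (sqrt 5 - 1) / 2"
    and "Q = sqrt ((1 + r0) / (r0\<^sup>2 * (1 - r0)) * C)"
    and "0 < \<alpha>" and "\<alpha> < Q"
    and "f \<in> \<H>_\<alpha> \<alpha> C"
    and "harmonic_parts f h g"
    and "\<And>z. z \<in> ball 0 1 \<Longrightarrow> (\<lambda>k. a (k + 1) * z ^ (k + 1)) sums h z"
    and "\<And>z. z \<in> ball 0 1 \<Longrightarrow> (\<lambda>k. b (k + 2) * z ^ (k + 2)) sums g z"
    and "n \<ge> 2"
  shows "cmod (a n) + cmod (b n) \<le>
           1 / (real n * r0 ^ (n - 1) * Q) *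
             (INF t\<in>{0<..<1}. (Q\<^sup>2 - \<alpha>\<^sup>2 * (1 - t)\<^sup>2) / (t ^ (n - 1) * (1 - t)))
       \<and> 1 / (real n * r0 ^ (n - 1) * Q) *
             (INF t\<in>{0<..<1}. (Q\<^sup>2 - \<alpha>\<^sup>2 * (1 - t)\<^sup>2) / (t ^ (n - 1) * (1 - t)))
           < Q / r0 ^ (n - 1) * (1 + 1 / (real n - 1)) ^ (n - 1)"
proof -
  \<comment> \<open>The values \<open>a 0\<close>, \<open>b 0\<close> and \<open>b 1\<close> are
    arbitrary; replacing them by 0 gives series indexed from 0.\<close>
  define A where "A k = (if k = 0 then 0 else a k)" for k
  define B where "B k = (if k < 2 then 0 else b k)" for k
  have A: "(\<lambda>k. A k * z ^ k) sums h z" if "z \<in> ball 0 1" for z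
    using assms(7)[OF that] sums_iff_shift[of "\<lambda>k. A k * z ^ k" 1 "h z"] by (simp add: A_def)
  have B: "(\<lambda>k. B k * z ^ k) sums g z" if "z \<in> ball 0 1" for z
    using assms(8)[OF that] sums_iff_shift[of "\<lambda>k. B k * z ^ k" 2 "g z"]
    by (simp add: B_def numeral_2_eq_2)
  \<comment> \<open>The factor (1 + r) / (r^2 (1 - r)) is smallest on (0,1) where 1 - r^2 = r, that
    is, at \<open>r0\<close>. The bounds come from 1 < sqrt 5 < 3.\<close>
  have r0: "0 < r0" "r0 < 1"
    using real_less_rsqrt[of 1 5] real_sqrt_less_mono[of 5 9] unfolding assms(1) by auto
  have Q: "0 < Q" using assms(3,4) by simp
  \<comment> \<open>Since \<open>sqrt\<close> is negative at negative reals, 0 < Q forces a positive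
    radicand.\<close>
  then have Q2: "Q\<^sup>2 = (1 + r0) / (r0\<^sup>2 * (1 - r0)) * C"
    unfolding assms(2) by simp
  have f: "f \<in> \<H>_C C" using assms(5) by (simp add: \<H>_\<alpha>_def)
  have "deriv h 0 = A 1"
    using sums_power_series_at_0[of "diffs A" "deriv h 0"] deriv_sums_diffs[OF A, of 0]
    by (simp add: diffs_def)
  then have A1: "A 1 = of_real \<alpha>"
    using assms(5) wirtinger_harmonic(1)[OF assms(6), of 0] by (simp add: \<H>_\<alpha>_def)
  define m where "m = n - 1"
  have m: "m \<noteq> 0" "n = Suc m" using assms(9) by (auto simp: m_def)
  let ?v = "\<lambda>t. (Q\<^sup>2 - \<alpha>\<^sup>2 * (1 - t)\<^sup>2) / (t ^ m * (1 - t))"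
  define c where "c = real n * r0 ^ m * (cmod (a n) + cmod (b n))"
  have le: "c * Q \<le> ?v t" if t: "t \<in> {0<..<1}" for t
  proof -
    let ?x = "t ^ m * (1 - t)"
    have "t ^ m \<le> t ^ 1" using t m(1) by (intro power_decreasing) auto
    then have x: "0 < ?x" "?x \<le> t"
      using t mult_mono[of "t ^ m" t "1 - t" 1] by auto
    have "\<alpha>\<^sup>2 + c\<^sup>2 * ?x \<le> Q\<^sup>2"
      using coefficient_area_bound[OF f assms(6) A B r0, of t m] t m A1
      by (simp add: Q2 c_def A_def B_def)
    from le_divide_of_square_bound[OF this x] t Q have "c \<le> (Q\<^sup>2 - \<alpha>\<^sup>2 * (1 - t)\<^sup>2) / (Q * ?x)"
      by simp
    then have "c * Q \<le> (Q\<^sup>2 - \<alpha>\<^sup>2 * (1 - t)\<^sup>2) / (Q * ?x) * Q"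
      using Q by (intro mult_right_mono) auto
    then show ?thesis using Q by simp
  qed
  have "c * Q \<le> (INF t\<in>{0<..<1}. ?v t)"
    using le by (intro cINF_greatest) auto
  then have 1: "cmod (a n) + cmod (b n) \<le> 1 / (real n * r0 ^ m * Q) * (INF t\<in>{0<..<1}. ?v t)"
    using Q r0 m(2) unfolding c_def times_divide_eq_left mult_1
    by (subst pos_le_divide_eq) (auto simp: mult_ac)
  define s where "s = real m / real n"
  have s: "0 < s" "s < 1" using m by (auto simp: s_def)
  \<comment> \<open>These identities turn 1 / (s^m (1 - s)) into n (1 + 1/(n - 1))^m.\<close>
  have s1: "1 - s = 1 / real n" "1 + 1 / (real n - 1) = 1 / s"
    using m(1) unfolding s_def m(2) by (simp_all add: divide_simps)
  \<comment> \<open>The lower bound \<open>c * Q\<close> ensures that the real infimum lies below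
    each value.\<close>
  have "(INF t\<in>{0<..<1}. ?v t) \<le> ?v s"
    using le s by (intro cINF_lower bdd_belowI2[of _ "c * Q"]) auto
  \<comment> \<open>Strictness comes from dropping the positive term \<alpha>^2 (1 - s)^2.\<close>
  also have "\<dots> < Q\<^sup>2 / (s ^ m * (1 - s))"
    using s assms(3) by (intro divide_strict_right_mono) auto
  also have "\<dots> = real n * r0 ^ m * Q * (Q / r0 ^ m * (1 + 1 / (real n - 1)) ^ m)"
    using r0(1) unfolding s1 by (simp add: power_divide power2_eq_square)
  finally have "1 / (real n * r0 ^ m * Q) * (INF t\<in>{0<..<1}. ?v t)
      < Q / r0 ^ m * (1 + 1 / (real n - 1)) ^ m"
    using Q r0(1) m(2) unfolding times_divide_eq_left mult_1
    by (subst pos_divide_less_eq) (auto simp: mult_ac)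
  with 1 show ?thesis unfolding m_def ..
qed

end
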